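(* Let $W$ be the Graham--Rothschild semigroup over a finite alphabet $A$, and let $\mathcal F'$ be the collection of substitution maps $u\mapsto u[\tilde w]$ given by strong infinite parameter words $\tilde w$. Then there is an $\mathcal F'$-coherent element $(\alpha_i)_{i<\omega}\in\Pi_W=\prod_{i<\omega}{}^*W_i$.
   Context: Graham--Rothschild semigroup: fix a finite alphabet $A$ and variables $x_1,x_2,\dots$. For $k\in\mathbb N$, $W_k$ is the set of finite words over $A\cup\{x_1,\dots,x_k\}$ in which each of $x_1,\dots,x_k$ occurs and whose first occurrences are in increasing order ($W_0=A^{<\omega}$). $W=\bigcup_k W_k$ is a semigroup under concatenation, layered by $\ell(w)=$ the number of variables occurring in $w$ (so the layers are $W_k$). An infinite parameter word is $\tilde w\in(A\cup\{x_1,x_2,\dots\})^\omega$ in which every $x_i$ occurs and first occurrences are in increasing order; it is strong if for $i<j$ every occurrence of $x_i$ precedes every occurrence of $x_j$. The substitution map $u\mapsto u[\tilde w]$ replaces each occurrence of $x_i$ in $u$ by the $i$-th character of $\tilde w$. Nonstandard framework: a universe with an iterable star map $M\mapsto{}^*M$ satisfying the usual properties (sets extend to sets containing the standard ones, functions extend, ${}^*w=w$ for $w\in W$, ${}^*n=n$) and transfer for bounded-quantifier formulas; extended maps are denoted by the same symbol. For $\alpha\in{}^{*m}W$, $\mathcal U_\alpha=\{B\subseteq W:\alpha\in{}^{*m}B\}$ and $\alpha\sim\beta$ iff $\mathcal U_\alpha=\mathcal U_\beta$. A sequence $(\alpha_i)_{i<\omega}$ with $\alpha_i\in{}^*W_i$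 is $\mathcal F'$-coherent if for every $f\in\mathcal F'$ and every $j$ there is $k\le j$ with $f(\alpha_j)\sim\alpha_k$.
   Formalization: The star map is also assumed to be c⁺-enlarging (any family of at most continuum many sets with the finite intersection property has a common point in the stars); with transfer alone the claim fails, e.g. for the identity star map when |A| ≥ 2. *)

theory Defs
  imports Complex_Main "HOL-Library.FuncSet" "HOL-Library.Equipollence"
begin

section \<open>Words and parameter words\<close>

text \<open>\<open>Var i\<close> is the variable \<open>x\<^sub>i\<close>; only indices \<open>i \<ge> 1\<close> are used.\<close>

datatype 'a letter = Const 'a | Var nat

text \<open>\<open>gr_layer A k\<close> is the set \<open>W\<^sub>k\<close>.\<close>

definition first_occ :: "'b list \<Rightarrow> 'b \<Rightarrow> nat" where
  "first_occ u c = (LEAST n. n < length u \<and> u ! n = c)"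

definition gr_layer :: "'a set \<Rightarrow> nat \<Rightarrow> 'a letter list set" where
  "gr_layer A k = {u. set u \<subseteq> Const ` A \<union> Var ` {1..k} \<and> Var ` {1..k} \<subseteq> set u \<and>
     (\<forall>i j. 1 \<le> i \<and> i < j \<and> j \<le> k \<longrightarrow> first_occ u (Var i) < first_occ u (Var j))}"

definition inf_param_word :: "'a set \<Rightarrow> (nat \<Rightarrow> 'a letter) \<Rightarrow> bool" where
  "inf_param_word A w \<longleftrightarrow>
     range w \<subseteq> Const ` A \<union> Var ` {1..} \<and> Var ` {1..} \<subseteq> range w \<and>
     (\<forall>i j. 1 \<le> i \<and> i < j \<longrightarrow> (LEAST n. w n = Var i) < (LEAST n. w n = Var j))"

definition strong_param_word :: "'a set \<Rightarrow> (nat \<Rightarrow> 'a letter) \<Rightarrow> bool" where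
  "strong_param_word A w \<longleftrightarrow> inf_param_word A w \<and>
     (\<forall>i j p q. 1 \<le> i \<and> i < j \<and> w p = Var i \<and> w q = Var j \<longrightarrow> p < q)"

text \<open>Positions of an infinite word are numbered from 0, so its \<open>i\<close>-th character is \<open>w (i - 1)\<close>.\<close>

definition subst_word :: "(nat \<Rightarrow> 'a letter) \<Rightarrow> 'a letter list \<Rightarrow> 'a letter list" where
  "subst_word w u = map (\<lambda>c. case c of Const a \<Rightarrow> Const a | Var i \<Rightarrow> w (i - 1)) u"

definition strong_substs :: "'a set \<Rightarrow> ('a letter list \<Rightarrow> 'a letter list) set" where
  "strong_substs A = {subst_word w | w. strong_param_word A w}"


section \<open>Bounded formulas\<close>

text \<open>Bounded-quantifier formulas in the language of membership, with variables named by natural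
  numbers: \<open>BAll i j \<phi>\<close> is \<open>\<forall>v\<^sub>i \<in> v\<^sub>j. \<phi>\<close> and \<open>BEx i j \<phi>\<close> is \<open>\<exists>v\<^sub>i \<in> v\<^sub>j. \<phi>\<close>.\<close>

datatype bfm =
    Mem nat nat | Eql nat nat
  | Neg bfm | Conj bfm bfm | Disj bfm bfm | Impl bfm bfm
  | BAll nat nat bfm | BEx nat nat bfm

fun bsat :: "('v \<Rightarrow> 'v \<Rightarrow> bool) \<Rightarrow> (nat \<Rightarrow> 'v) \<Rightarrow> bfm \<Rightarrow> bool" where
  "bsat E e (Mem i j) \<longleftrightarrow> E (e i) (e j)"
| "bsat E e (Eql i j) \<longleftrightarrow> e i = e j"
| "bsat E e (Neg p) \<longleftrightarrow> \<not> bsat E e p"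
| "bsat E e (Conj p q) \<longleftrightarrow> bsat E e p \<and> bsat E e q"
| "bsat E e (Disj p q) \<longleftrightarrow> bsat E e p \<or> bsat E e q"
| "bsat E e (Impl p q) \<longleftrightarrow> (bsat E e p \<longrightarrow> bsat E e q)"
| "bsat E e (BAll i j p) \<longleftrightarrow> (\<forall>a. E a (e j) \<longrightarrow> bsat E (e(i := a)) p)"
| "bsat E e (BEx i j p) \<longleftrightarrow> (\<exists>a. E a (e j) \<and> bsat E (e(i := a)) p)"


section \<open>Nonstandard universes with an iterable star map\<close>

text \<open>A universe is a type \<open>'v\<close> of entities (sets and atoms) with a membership relation.  The star
  map goes from the universe to itself, so that it can be iterated.\<close>

record 'v star_universe =
  elt :: "'v \<Rightarrow> 'v \<Rightarrow> bool"
  is_set :: "'v \<Rightarrow> bool"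
  star :: "'v \<Rightarrow> 'v"

definition members :: "'v star_universe \<Rightarrow> 'v \<Rightarrow> 'v set" where
  "members U s = {x. elt U x s}"

definition in_universe :: "'v star_universe \<Rightarrow> 'v set \<Rightarrow> bool" where
  "in_universe U X \<longleftrightarrow> (\<exists>s. is_set U s \<and> members U s = X)"

definition coll :: "'v star_universe \<Rightarrow> 'v set \<Rightarrow> 'v" where
  "coll U X = (THE s. is_set U s \<and> members U s = X)"

definition opair :: "'v star_universe \<Rightarrow> 'v \<Rightarrow> 'v \<Rightarrow> 'v" where
  "opair U a b = coll U {coll U {a}, coll U {a, b}}"

text \<open>The closure conditions on the universe hold in every superstructure, where the set universe is
  moreover closed under power sets.  Power sets are not required here: closure under them would
  make the type \<open>'v\<close> larger than every type in the standard model of HOL.  The last condition is the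
  enlarging property for families of at most continuum many sets, which guarantees that every
  ultrafilter on a countable set of the universe is generated by some element of its star.  Transfer
  alone does not give this (the identity map satisfies transfer).\<close>

locale nonstandard_universe =
  fixes U :: "'v star_universe"
  assumes atoms_empty: "\<not> is_set U a \<Longrightarrow> members U a = {}"
    and extensional: "is_set U s \<Longrightarrow> is_set U t \<Longrightarrow> members U s = members U t \<Longrightarrow> s = t"
    and closed_pair: "in_universe U {a, b}"
    and closed_subset: "in_universe U X \<Longrightarrow> Y \<subseteq> X \<Longrightarrow> in_universe U Y"
    and closed_Union: "is_set U s \<Longrightarrow> in_universe U (\<Union>x\<in>members U s. members U x)"
    and closed_Times: "in_universe U X \<Longrightarrow> in_universe U Y \<Longrightarrow>
          in_universe U {opair U a b | a b. a \<in> X \<and> b \<in> Y}"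
    and star_is_set: "is_set U (star U s) \<longleftrightarrow> is_set U s"
    and transfer: "bsat (elt U) e p \<longleftrightarrow> bsat (elt U) (star U \<circ> e) p"
    and enlarging: "\<lbrakk>\<forall>X\<in>F. in_universe U X; F \<lesssim> (UNIV :: real set);
          \<forall>G. G \<subseteq> F \<and> finite G \<and> G \<noteq> {} \<longrightarrow> \<Inter>G \<noteq> {}\<rbrakk> \<Longrightarrow>
          \<exists>\<alpha>. \<forall>X\<in>F. \<alpha> \<in> members U (star U (coll U X))"

text \<open>\<open>\<iota>\<close> identifies \<open>S\<close> with a set of the universe all of whose elements are fixed by the star map.\<close>

definition standard_copy :: "'v star_universe \<Rightarrow> ('b \<Rightarrow> 'v) \<Rightarrow> 'b set \<Rightarrow> bool" where
  "standard_copy U \<iota> S \<longleftrightarrow>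
     inj_on \<iota> S \<and> in_universe U (\<iota> ` S) \<and> (\<forall>x\<in>S. star U (\<iota> x) = \<iota> x)"

text \<open>In the following, \<open>m\<close> is the number of iterations of the star map: \<open>hyper_ext U \<iota> m B\<close> is the
  set of elements of the \<open>m\<close>-fold star of \<open>B\<close>, \<open>hyper_map U \<iota> S m f\<close> is the extension of
  \<open>f : S \<rightarrow> S\<close> to the \<open>m\<close>-fold star of \<open>S\<close> (obtained by applying star to the graph of \<open>f\<close>), and
  \<open>generated U \<iota> S m \<alpha>\<close> is the ultrafilter on \<open>S\<close> generated by \<open>\<alpha>\<close>.\<close>

definition hyper_ext :: "'v star_universe \<Rightarrow> ('b \<Rightarrow> 'v) \<Rightarrow> nat \<Rightarrow> 'b set \<Rightarrow> 'v set" where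
  "hyper_ext U \<iota> m B = members U ((star U ^^ m) (coll U (\<iota> ` B)))"

definition hyper_map ::
  "'v star_universe \<Rightarrow> ('b \<Rightarrow> 'v) \<Rightarrow> 'b set \<Rightarrow> nat \<Rightarrow> ('b \<Rightarrow> 'b) \<Rightarrow> 'v \<Rightarrow> 'v" where
  "hyper_map U \<iota> S m f \<alpha> =
     (THE \<beta>. opair U \<alpha> \<beta> \<in> members U ((star U ^^ m) (coll U {opair U (\<iota> u) (\<iota> (f u)) | u. u \<in> S})))"

definition generated :: "'v star_universe \<Rightarrow> ('b \<Rightarrow> 'v) \<Rightarrow> 'b set \<Rightarrow> nat \<Rightarrow> 'v \<Rightarrow> 'b set set" where
  "generated U \<iota> S m \<alpha> = {B. B \<subseteq> S \<and> \<alpha> \<in> hyper_ext U \<iota> m B}"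

text \<open>\<open>\<alpha> \<sim> \<beta>\<close> for \<open>\<alpha>\<close> in the \<open>m\<close>-fold and \<open>\<beta>\<close> in the \<open>n\<close>-fold star of \<open>S\<close>.\<close>

definition sim ::
  "'v star_universe \<Rightarrow> ('b \<Rightarrow> 'v) \<Rightarrow> 'b set \<Rightarrow> nat \<Rightarrow> nat \<Rightarrow> 'v \<Rightarrow> 'v \<Rightarrow> bool" where
  "sim U \<iota> S m n \<alpha> \<beta> \<longleftrightarrow> generated U \<iota> S m \<alpha> = generated U \<iota> S n \<beta>"

text \<open>Here \<open>L i\<close> is the \<open>i\<close>-th layer of the layered set \<open>\<Union>i. L i\<close>.\<close>

definition star_Pi :: "'v star_universe \<Rightarrow> ('b \<Rightarrow> 'v) \<Rightarrow> (nat \<Rightarrow> 'b set) \<Rightarrow> (nat \<Rightarrow> 'v) set" where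
  "star_Pi U \<iota> L = (\<Pi> i\<in>UNIV. hyper_ext U \<iota> 1 (L i))"

definition coherent ::
  "'v star_universe \<Rightarrow> ('b \<Rightarrow> 'v) \<Rightarrow> (nat \<Rightarrow> 'b set) \<Rightarrow> ('b \<Rightarrow> 'b) set \<Rightarrow> (nat \<Rightarrow> 'v) \<Rightarrow> bool" where
  "coherent U \<iota> L F \<alpha> \<longleftrightarrow>
     (\<forall>f\<in>F. \<forall>j. \<exists>k\<le>j. sim U \<iota> (\<Union>i. L i) 1 1 (hyper_map U \<iota> (\<Union>i. L i) 1 f (\<alpha> j)) (\<alpha> k))"

end

theory Submission
  imports Defs "HOL-Analysis.Abstract_Topology_2"
begin

text \<open>
  Let \<open>p\<^sub>0\<close> be a minimal idempotent ultrafilter on \<open>W\<^sub>0\<close> and \<open>p\<^sub>1 \<le> p\<^sub>0\<close> an idempotent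
  ultrafilter on \<open>W\<^sub>1\<close>. Substituting a letter for \<open>x\<^sub>1\<close> sends \<open>p\<^sub>1\<close> to an idempotent below
  \<open>p\<^sub>0\<close>, hence to \<open>p\<^sub>0\<close>. Write \<open>p\<^sub>1[x\<^sub>i]\<close> for the image of \<open>p\<^sub>1\<close> under \<open>x\<^sub>1 \<mapsto> x\<^sub>i\<close> and put
  \<open>q\<^sub>j = p\<^sub>0 p\<^sub>1[x\<^sub>1] \<dots> p\<^sub>1[x\<^sub>j]\<close>. A substitution by a strong word \<open>w\<close> turns the factors of \<open>q\<^sub>j\<close>
  into copies of \<open>p\<^sub>0\<close> and, in blocks of increasing variables, copies of the \<open>p\<^sub>1[x\<^sub>i]\<close>. The
  former are absorbed by their left neighbour and the latter are idempotent, so the image is \<open>q\<^sub>k\<close>,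
  where \<open>k\<close> is the number of variables among the first \<open>j\<close> characters of \<open>w\<close>. Finally \<open>q\<^sub>j\<close> is generated
  by some \<open>\<alpha>\<^sub>j \<in> *W\<^sub>j\<close> because the star map is an enlargement, and by transfer the extension of
  a map to \<open>*W\<close> acts on generators as the map acts on ultrafilters.
\<close>

section \<open>Filters and ultrafilters\<close>

definition ultra :: "'s filter \<Rightarrow> bool" where
  "ultra p \<longleftrightarrow> p \<noteq> bot \<and> (\<forall>P. eventually P p \<or> eventually (\<lambda>x. \<not> P x) p)"

lemma ultra_not: "ultra p \<Longrightarrow> eventually (\<lambda>x. \<not> P x) p \<longleftrightarrow> \<not> eventually P p"
  unfolding ultra_def using eventually_conj[of P p "\<lambda>x. \<not> P x"]
  by (auto simp: trivial_limit_def)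

text \<open>Finer filters are smaller in this order, so ultrafilters are the minimal proper filters:
  if \<open>q\<close> gained a set, it would also contain the complement, inherited from
  \<open>p\<close>.\<close>

lemma ultra_eqI:
  assumes "ultra p" "q \<noteq> bot" "q \<le> p"
  shows "q = p"
proof (rule antisym)
  show "p \<le> q"
    unfolding le_filter_def
  proof (intro allI impI)
    fix P assume P: "eventually P q"
    show "eventually P p"
    proof (rule ccontr)
      assume "\<not> eventually P p"
      then have "eventually (\<lambda>x. \<not> P x) q"
        using assms by (metis ultra_not filter_leD)
      with P show False
        using assms(2) eventually_conj[of P q "\<lambda>x. \<not> P x"] by (simp add: trivial_limit_def)
    qed
  qed
qed fact

lemma ultra_filtermap: "ultra p \<Longrightarrow> ultra (filtermap h p)"
  unfolding ultra_def by (auto simp: eventually_filtermap filtermap_bot_iff)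

lemma filtermap_eventually_id:
  fixes h :: "'s \<Rightarrow> 's"
  assumes "eventually (\<lambda>x. h x = x) p"
  shows "filtermap h p = p"
  unfolding filter_eq_iff eventually_filtermap
proof
  fix P :: "'s \<Rightarrow> bool"
  have "eventually (\<lambda>x. P (h x) = P x) p" using assms by eventually_elim simp
  then show "eventually (\<lambda>x. P (h x)) p = eventually P p" by (rule eventually_subst)
qed

text \<open>Zorn's lemma for nonempty closed sets of ultrafilters with a property stable under
  intersections. The infimum of a chain of proper filters is proper because the chain is directed;
  this is compactness of the space of ultrafilters.\<close>

lemma filter_minimal:
  fixes Q :: "'s filter \<Rightarrow> bool"
  assumes "Q F0" "F0 \<noteq> bot"
    and Inf: "\<And>C. C \<noteq> {} \<Longrightarrow> \<forall>F\<in>C. Q F \<Longrightarrow> Q (Inf C)"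
  obtains F where "Q F" "F \<noteq> bot" "F \<le> F0" "\<And>G. Q G \<Longrightarrow> G \<noteq> bot \<Longrightarrow> G \<le> F \<Longrightarrow> G = F"
proof -
  define A where "A = {F. Q F \<and> F \<noteq> bot \<and> F \<le> F0}"
  have "\<exists>m\<in>A. \<forall>a\<in>A. m \<ge> a \<longrightarrow> a = m"
  proof (rule predicate_Zorn)
    show "partial_order_on A (relation_of (\<ge>) A)"
      by (rule partial_order_on_relation_ofI) auto
    fix C assume C: "C \<in> Chains (relation_of (\<ge>) A)"
    then have CA: "C \<subseteq> A"
      by (auto simp: Chains_def relation_of_def)
    have ch: "a \<le> b \<or> b \<le> a" if "a \<in> C" "b \<in> C" for a b
      using C that by (auto simp: Chains_def relation_of_def)
    show "\<exists>u\<in>A. \<forall>a\<in>C. a \<ge> u"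
    proof (cases "C = {}")
      case True
      then show ?thesis using assms(1,2) by (auto simp: A_def)
    next
      case False
      have "(INF F\<in>C. F) = bot \<longleftrightarrow> (\<exists>F\<in>C. F = bot)"
        by (rule INF_filter_bot_base) (metis ch inf.absorb1 inf.absorb2 order_refl)
      then have "Inf C \<noteq> bot" using CA by (auto simp: A_def)
      moreover have "Inf C \<le> F0" using False CA
        by (metis (no_types, lifting) A_def Inf_lower2 ex_in_conv mem_Collect_eq subsetD)
      moreover have "Q (Inf C)" using Inf[OF False] CA by (auto simp: A_def)
      ultimately show ?thesis
        by (intro bexI[of _ "Inf C"]) (auto simp: A_def Inf_lower)
    qed
  qed
  then obtain m where m: "m \<in> A" "\<And>a. a \<in> A \<Longrightarrow> a \<le> m \<Longrightarrow> a = m" by blast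
  show thesis
    by (rule that[of m]) (use m in \<open>auto simp: A_def intro: order_trans\<close>)
qed

lemma inf_principal_eq_bot: "inf F (principal {x. P x}) = bot \<longleftrightarrow> eventually (\<lambda>x. \<not> P x) F"
  by (simp add: trivial_limit_def eventually_inf_principal)

text \<open>A minimal proper filter is an ultrafilter: restricting it to a set either gives
  \<open>bot\<close>, so that it contains the complement, or changes nothing, so that it contains
  the set.\<close>

lemma ultra_exists:
  assumes "F \<noteq> bot"
  obtains p where "ultra p" "p \<le> F"
proof -
  obtain p where p: "p \<noteq> bot" "p \<le> F" "\<And>G. G \<noteq> bot \<Longrightarrow> G \<le> p \<Longrightarrow> G = p"
    by (rule filter_minimal[of "\<lambda>_. True" F]) (use assms in auto)
  have "eventually P p \<or> eventually (\<lambda>x. \<not> P x) p" for P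
  proof (cases "inf p (principal {x. P x}) = bot")
    case True
    then show ?thesis by (simp add: inf_principal_eq_bot)
  next
    case False
    then have "inf p (principal {x. P x}) = p" by (intro p(3)) auto
    then have "p \<le> principal {x. P x}" by (metis inf.cobounded2)
    then show ?thesis by (simp add: le_principal)
  qed
  then show thesis using p that by (auto simp: ultra_def)
qed

text \<open>If a set is not in \<open>F\<close>, then \<open>F\<close> stays proper on its
  complement, and an ultrafilter below that restriction omits the set. Inequalities of filters can
  thus be tested on ultrafilters.\<close>

lemma eventually_if_ultra:
  assumes "\<And>p. ultra p \<Longrightarrow> p \<le> F \<Longrightarrow> eventually P p"
  shows "eventually P F"
proof (rule ccontr)
  assume "\<not> eventually P F"
  then have "inf F (principal {x. \<not> P x}) \<noteq> bot"
    unfolding inf_principal_eq_bot by simp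
  then obtain p where p: "ultra p" "p \<le> inf F (principal {x. \<not> P x})"
    by (rule ultra_exists)
  then have "eventually (\<lambda>x. \<not> P x) p" by (simp add: le_principal)
  with p assms show False by (simp add: ultra_not)
qed

section \<open>The semigroup of ultrafilters\<close>

definition fmul :: "('s \<Rightarrow> 's \<Rightarrow> 's) \<Rightarrow> 's filter \<Rightarrow> 's filter \<Rightarrow> 's filter" where
  "fmul f p q = Abs_filter (\<lambda>P. eventually (\<lambda>x. eventually (\<lambda>y. P (f x y)) q) p)"

lemma eventually_fmul:
  "eventually P (fmul f p q) \<longleftrightarrow> eventually (\<lambda>x. eventually (\<lambda>y. P (f x y)) q) p"
  unfolding fmul_def
proof (subst eventually_Abs_filter, rule is_filter.intro)
  fix P Q :: "'a \<Rightarrow> bool"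
  assume *: "\<forall>\<^sub>F x in p. \<forall>\<^sub>F y in q. P (f x y)"
  show "\<forall>\<^sub>F x in p. \<forall>\<^sub>F y in q. P (f x y) \<and> Q (f x y)"
    if "\<forall>\<^sub>F x in p. \<forall>\<^sub>F y in q. Q (f x y)"
    using * that by eventually_elim (rule eventually_conj)
  show "\<forall>\<^sub>F x in p. \<forall>\<^sub>F y in q. Q (f x y)" if "\<forall>x. P x \<longrightarrow> Q x"
    using * by eventually_elim (use that in \<open>auto elim: eventually_mono\<close>)
qed auto

lemma fmul_mono:
  assumes "p \<le> p'" "q \<le> q'"
  shows "fmul f p q \<le> fmul f p' q'"
  unfolding le_filter_def[of "fmul f p q"] eventually_fmul
proof (intro allI impI)
  fix P assume "\<forall>\<^sub>F x in p'. \<forall>\<^sub>F y in q'. P (f x y)"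
  with assms(1) have "\<forall>\<^sub>F x in p. \<forall>\<^sub>F y in q'. P (f x y)" by (rule filter_leD)
  then show "\<forall>\<^sub>F x in p. \<forall>\<^sub>F y in q. P (f x y)"
    by (rule eventually_mono) (rule filter_leD[OF assms(2)])
qed

lemma ultra_fmul: "ultra p \<Longrightarrow> ultra q \<Longrightarrow> ultra (fmul f p q)"
  by (simp add: ultra_def[of "fmul f p q"] trivial_limit_def eventually_fmul ultra_not)
    (simp add: ultra_def)

lemma fmul_neq_bot: "p \<noteq> bot \<Longrightarrow> q \<noteq> bot \<Longrightarrow> fmul f p q \<noteq> bot"
  by (simp add: trivial_limit_def eventually_fmul)

lemma fmul_principal:
  assumes "p \<le> principal X" "q \<le> principal Y" "\<And>x y. x \<in> X \<Longrightarrow> y \<in> Y \<Longrightarrow> f x y \<in> Z"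
  shows "fmul f p q \<le> principal Z"
proof -
  have "\<forall>\<^sub>F x in p. x \<in> X" "\<forall>\<^sub>F y in q. y \<in> Y"
    using assms by (simp_all add: le_principal)
  then have "\<forall>\<^sub>F x in p. \<forall>\<^sub>F y in q. f x y \<in> Z"
    by (auto elim!: eventually_mono intro: assms(3))
  then show ?thesis by (simp add: le_principal eventually_fmul)
qed

lemma filtermap_fmul:
  assumes "\<And>x y. h (f x y) = f (h x) (h y)"
  shows "filtermap h (fmul f p q) = fmul f (filtermap h p) (filtermap h q)"
  by (simp add: filter_eq_iff eventually_fmul eventually_filtermap assms)

text \<open>A filter stands for the closed set of the ultrafilters below it, so that
  \<open>fibre f F p r\<close> is the closed set \<open>{q \<le> F. q p = r}\<close>.\<close>

definition fibre :: "('s \<Rightarrow> 's \<Rightarrow> 's) \<Rightarrow> 's filter \<Rightarrow> 's filter \<Rightarrow> 's filter \<Rightarrow> 's filter" where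
  "fibre f F p r =
     (INF P\<in>{P. eventually P r}. inf F (principal {x. eventually (\<lambda>y. P (f x y)) p}))"

text \<open>The infimum yields only \<open>fmul f q p \<le> r\<close>, but between ultrafilters this
  is equality. The always true property contributes \<open>q \<le> F\<close>.\<close>

lemma le_fibre_iff:
  assumes "ultra p" "ultra q" "ultra r"
  shows "q \<le> fibre f F p r \<longleftrightarrow> q \<le> F \<and> fmul f q p = r"
proof -
  have "q \<le> fibre f F p r \<longleftrightarrow>
      (\<forall>P. eventually P r \<longrightarrow> q \<le> F \<and> eventually P (fmul f q p))"
    by (auto simp: fibre_def le_INF_iff le_principal eventually_fmul)
  then have "q \<le> fibre f F p r \<longleftrightarrow> q \<le> F \<and> fmul f q p \<le> r"
    unfolding le_filter_def[of "fmul f q p"] using eventually_True by blast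
  moreover have "fmul f q p \<le> r \<longleftrightarrow> fmul f q p = r"
    using assms ultra_eqI ultra_fmul ultra_def by (metis order_refl)
  ultimately show ?thesis by simp
qed

text \<open>Compactness: the filters under the infimum are directed, since conjunctions of
  properties of \<open>r\<close> are again such, so one of them would already be \<open>bot\<close>.
  Its property \<open>P\<close> would then fail almost everywhere for \<open>fmul f F p\<close>,
  hence for \<open>r\<close>.\<close>

lemma fibre_neq_bot:
  assumes "ultra p" "ultra r" "r \<le> fmul f F p"
  shows "fibre f F p r \<noteq> bot"
proof
  assume "fibre f F p r = bot"
  then have "\<exists>P\<in>{P. eventually P r}. inf F (principal {x. eventually (\<lambda>y. P (f x y)) p}) = bot"
    unfolding fibre_def
  proof (subst (asm) INF_filter_bot_base)
    fix P Q assume "P \<in> {P. eventually P r}" "Q \<in> {P. eventually P r}"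
    then show "\<exists>R\<in>{P. eventually P r}.
        inf F (principal {x. \<forall>\<^sub>F y in p. R (f x y)})
        \<le> inf (inf F (principal {x. \<forall>\<^sub>F y in p. P (f x y)}))
              (inf F (principal {x. \<forall>\<^sub>F y in p. Q (f x y)}))"
      by (intro bexI[of _ "\<lambda>x. P x \<and> Q x"])
        (auto intro!: le_infI2 simp: eventually_conj_iff)
  qed auto
  then obtain P where P: "eventually P r" "eventually (\<lambda>x. \<not> eventually (\<lambda>y. P (f x y)) p) F"
    by (auto simp: inf_principal_eq_bot)
  then have "eventually (\<lambda>z. \<not> P z) (fmul f F p)"
    using assms(1) by (simp add: eventually_fmul ultra_not)
  then show False
    using assms P(1) by (metis filter_leD ultra_not)
qed

text \<open>Any ultrafilter below the fibre over \<open>r\<close> serves as \<open>q\<close>. So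
  right multiplication by \<open>p\<close> maps closed sets onto closed sets.\<close>

lemma le_fmulE:
  assumes "ultra p" "ultra r" "r \<le> fmul f F p"
  obtains q where "ultra q" "q \<le> F" "fmul f q p = r"
  by (metis assms fibre_neq_bot le_fibre_iff ultra_exists)

definition closed_under_fmul :: "('s \<Rightarrow> 's \<Rightarrow> 's) \<Rightarrow> 's filter \<Rightarrow> bool" where
  "closed_under_fmul f F \<longleftrightarrow>
     (\<forall>p q. ultra p \<longrightarrow> p \<le> F \<longrightarrow> ultra q \<longrightarrow> q \<le> F \<longrightarrow> fmul f p q \<le> F)"

section \<open>Idempotents in compact right topological semigroups\<close>

context semigroup
begin

lemma fmul_assoc: "fmul f (fmul f p q) r = fmul f p (fmul f q r)"
  by (simp add: filter_eq_iff eventually_fmul assoc)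

text \<open>The Ellis-Numakura lemma. For \<open>p\<close> in a minimal closed subsemigroup
  \<open>F\<close>, the closed subsemigroup \<open>F p\<close> equals \<open>F\<close>, so
  \<open>q p = p\<close> for some \<open>q\<close>. Hence the fibre over \<open>p\<close> is a
  nonempty closed subsemigroup, so it is \<open>F\<close> too and contains \<open>p\<close>.\<close>

lemma ellis_idempotent:
  assumes "closed_under_fmul f F0" "F0 \<noteq> bot"
  obtains p where "ultra p" "p \<le> F0" "fmul f p p = p"
proof -
  obtain F where F: "closed_under_fmul f F" "F \<noteq> bot" "F \<le> F0"
    and min: "\<And>G. closed_under_fmul f G \<Longrightarrow> G \<noteq> bot \<Longrightarrow> G \<le> F \<Longrightarrow> G = F"
    by (rule filter_minimal[of "closed_under_fmul f", OF assms])
      (auto simp: closed_under_fmul_def le_Inf_iff)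
  obtain p where p: "ultra p" "p \<le> F" using F(2) by (rule ultra_exists)
  have "fmul f F p = F"
  proof (rule min)
    show "fmul f F p \<noteq> bot" using F(2) p(1) by (auto simp: ultra_def fmul_neq_bot)
    show "fmul f F p \<le> F"
      unfolding le_filter_def eventually_fmul
    proof (intro allI impI)
      fix P assume P: "eventually P F"
      show "eventually (\<lambda>x. eventually (\<lambda>y. P (f x y)) p) F"
      proof (rule eventually_if_ultra)
        fix q assume "ultra q" "q \<le> F"
        then have "fmul f q p \<le> F" using F(1) p by (auto simp: closed_under_fmul_def)
        then have "eventually P (fmul f q p)" using P by (rule filter_leD)
        then show "eventually (\<lambda>x. eventually (\<lambda>y. P (f x y)) p) q" by (simp add: eventually_fmul)
      qed
    qed
    show "closed_under_fmul f (fmul f F p)"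
      unfolding closed_under_fmul_def
    proof (intro allI impI)
      fix r r' assume r: "ultra r" "r \<le> fmul f F p" "ultra r'" "r' \<le> fmul f F p"
      obtain q where q: "ultra q" "q \<le> F" "fmul f q p = r" using p r by (metis le_fmulE)
      obtain q' where q': "ultra q'" "q' \<le> F" "fmul f q' p = r'" using p r by (metis le_fmulE)
      \<comment> \<open>By associativity \<open>(q p) (q' p) = (q (p q')) p\<close>, so it is enough
        to keep the left factor in \<open>F\<close>.\<close>
      have "fmul f q (fmul f p q') \<le> F"
        using F(1) p q q' by (simp add: closed_under_fmul_def ultra_fmul)
      then have "fmul f (fmul f q (fmul f p q')) p \<le> fmul f F p" by (rule fmul_mono) simp
      then show "fmul f r r' \<le> fmul f F p" by (simp add: fmul_assoc flip: q(3) q'(3))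
    qed
  qed
  then obtain q where q: "ultra q" "q \<le> F" "fmul f q p = p" using p by (metis le_fmulE)
  have "fibre f F p p = F"
  proof (rule min)
    show "fibre f F p p \<noteq> bot"
      using q p by (metis le_fibre_iff ultra_def bot.extremum_uniqueI)
    show "fibre f F p p \<le> F"
      unfolding fibre_def by (rule INF_lower2[of "\<lambda>_. True"]) auto
    show "closed_under_fmul f (fibre f F p p)"
      unfolding closed_under_fmul_def
      using F(1) p by (auto simp: le_fibre_iff ultra_fmul fmul_assoc closed_under_fmul_def)
  qed
  then have "fmul f p p = p" using p le_fibre_iff by metis
  moreover have "p \<le> F0" using p(2) F(3) by (rule order_trans)
  ultimately show thesis using that[OF p(1)] by blast
qed

text \<open>Choose \<open>p\<close> idempotent in a minimal closed left ideal \<open>F\<close>. An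
  idempotent \<open>e\<close> below \<open>p\<close> lies in \<open>F\<close> because
  \<open>e = e p\<close>, so the left ideal generated by \<open>e\<close> is all of
  \<open>F\<close>. Thus \<open>p = q e\<close> for some \<open>q\<close>, whence
  \<open>p e = p\<close>, while \<open>p e = e\<close>.\<close>

lemma minimal_idempotent:
  assumes "\<And>x y. x \<in> X \<Longrightarrow> y \<in> X \<Longrightarrow> f x y \<in> X" "X \<noteq> {}"
  obtains p where "ultra p" "p \<le> principal X" "fmul f p p = p"
    and "\<And>e. ultra e \<Longrightarrow> e \<le> principal X \<Longrightarrow> fmul f e e = e \<Longrightarrow> fmul f e p = e \<Longrightarrow>
      fmul f p e = e \<Longrightarrow> e = p"
proof -
  define Q where "Q F \<longleftrightarrow> F \<le> principal X \<and>
      (\<forall>p q. ultra p \<longrightarrow> p \<le> principal X \<longrightarrow> ultra q \<longrightarrow> q \<le> F \<longrightarrow> fmul f p q \<le> F)" for F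
  have mulX: "fmul f p q \<le> principal X" if "p \<le> principal X" "q \<le> principal X" for p q
    by (rule fmul_principal[OF that]) (rule assms(1))
  then have "Q (principal X)" by (simp add: Q_def)
  moreover have "principal X \<noteq> bot" using assms(2) by (simp add: principal_eq_bot_iff)
  ultimately obtain F where F: "Q F" "F \<noteq> bot"
    and min: "\<And>G. Q G \<Longrightarrow> G \<noteq> bot \<Longrightarrow> G \<le> F \<Longrightarrow> G = F"
  proof (rule filter_minimal)
    fix C :: "'a filter set" assume "C \<noteq> {}" and Q: "\<forall>F\<in>C. Q F"
    then obtain F where "F \<in> C" by blast
    with Q have "Inf C \<le> principal X" unfolding Q_def by (meson Inf_lower2)
    with Q show "Q (Inf C)" by (simp add: Q_def le_Inf_iff)
  qed blast
  have FX: "F \<le> principal X" using F(1) by (simp add: Q_def)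
  then have "closed_under_fmul f F"
    using F(1) by (auto simp: Q_def closed_under_fmul_def)
  then obtain p where p: "ultra p" "p \<le> F" "fmul f p p = p"
    using F(2) by (rule ellis_idempotent)
  have "e = p" if e: "ultra e" "e \<le> principal X" "fmul f e e = e" "fmul f e p = e" "fmul f p e = e"
    for e
  proof -
    have eF: "e \<le> F" using F(1) e p by (metis Q_def)
    have "fmul f (principal X) e = F"
    proof (rule min)
      show "fmul f (principal X) e \<noteq> bot"
        using \<open>principal X \<noteq> bot\<close> e(1) by (auto simp: ultra_def fmul_neq_bot)
      show "fmul f (principal X) e \<le> F"
        unfolding le_filter_def eventually_fmul
      proof (intro allI impI)
        fix P assume P: "eventually P F"
        show "eventually (\<lambda>x. eventually (\<lambda>y. P (f x y)) e) (principal X)"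
        proof (rule eventually_if_ultra)
          fix q assume "ultra q" "q \<le> principal X"
          then have "fmul f q e \<le> F" using F(1) e eF by (auto simp: Q_def)
          then have "eventually P (fmul f q e)" using P by (rule filter_leD)
          then show "eventually (\<lambda>x. eventually (\<lambda>y. P (f x y)) e) q" by (simp add: eventually_fmul)
        qed
      qed
      show "Q (fmul f (principal X) e)"
        unfolding Q_def
      proof (intro conjI allI impI)
        show "fmul f (principal X) e \<le> principal X"
          using order_refl e(2) by (rule mulX)
        fix s r assume s: "ultra s" "s \<le> principal X" and r: "ultra r" "r \<le> fmul f (principal X) e"
        obtain q where q: "ultra q" "q \<le> principal X" "fmul f q e = r" using e r by (metis le_fmulE)
        have "fmul f s q \<le> principal X" using s(2) q(2) by (rule mulX)
        then have "fmul f (fmul f s q) e \<le> fmul f (principal X) e" by (rule fmul_mono) simp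
        then show "fmul f s r \<le> fmul f (principal X) e" by (simp add: fmul_assoc flip: q(3))
      qed
    qed
    then obtain q where "fmul f q e = p" using e p by (metis le_fmulE)
    then show "e = p" using e by (metis fmul_assoc)
  qed
  moreover have "p \<le> principal X" using p(2) FX by (rule order_trans)
  ultimately show thesis using that[OF p(1) _ p(3)] by blast
qed

text \<open>The ultrafilter core of the Hales--Jewett theorem: \<open>X\<close> are the words without and \<open>Y\<close> the words
  with variables, and a retraction substitutes a constant. It sends \<open>p\<^sub>1\<close> to an idempotent below
  the minimal \<open>p\<^sub>0\<close>, hence to \<open>p\<^sub>0\<close>.\<close>

lemma retraction_idempotents:
  assumes XX: "\<And>x y. x \<in> X \<Longrightarrow> y \<in> X \<Longrightarrow> f x y \<in> X"
    and YY: "\<And>x y. x \<in> Y \<Longrightarrow> y \<in> Y \<Longrightarrow> f x y \<in> Y"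
    and XY: "\<And>x y. x \<in> X \<Longrightarrow> y \<in> Y \<Longrightarrow> f x y \<in> Y"
    and YX: "\<And>x y. x \<in> Y \<Longrightarrow> y \<in> X \<Longrightarrow> f x y \<in> Y"
    and ne: "X \<noteq> {}" "Y \<noteq> {}"
    and hom: "\<And>r x y. r \<in> R \<Longrightarrow> r (f x y) = f (r x) (r y)"
    and rX: "\<And>r x. r \<in> R \<Longrightarrow> x \<in> X \<Longrightarrow> r x = x"
    and rY: "\<And>r y. r \<in> R \<Longrightarrow> y \<in> Y \<Longrightarrow> r y \<in> X"
  obtains p0 p1 where "ultra p0" "p0 \<le> principal X" "fmul f p0 p0 = p0"
    "ultra p1" "p1 \<le> principal Y" "fmul f p1 p1 = p1"
    "fmul f p0 p1 = p1" "fmul f p1 p0 = p1" "\<And>r. r \<in> R \<Longrightarrow> filtermap r p1 = p0"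
proof -
  obtain p where p: "ultra p" "p \<le> principal X" "fmul f p p = p"
    and min: "\<And>e. ultra e \<Longrightarrow> e \<le> principal X \<Longrightarrow> fmul f e e = e \<Longrightarrow> fmul f e p = e \<Longrightarrow>
      fmul f p e = e \<Longrightarrow> e = p"
    using minimal_idempotent[OF XX ne(1)] by metis
  \<comment> \<open>An idempotent of this form \<open>q p\<close> is fixed by right multiplication
    with \<open>p\<close>.\<close>
  define F where "F = fmul f (principal Y) p"
  have "closed_under_fmul f F"
    unfolding closed_under_fmul_def
  proof (intro allI impI)
    fix r r' assume r: "ultra r" "r \<le> F" "ultra r'" "r' \<le> F"
    obtain q where q: "ultra q" "q \<le> principal Y" "fmul f q p = r"
      using p r unfolding F_def by (metis le_fmulE)
    obtain q' where q': "ultra q'" "q' \<le> principal Y" "fmul f q' p = r'"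
      using p r unfolding F_def by (metis le_fmulE)
    have "fmul f p q' \<le> principal Y" by (rule fmul_principal[OF p(2) q'(2)]) (rule XY)
    with q(2) have "fmul f q (fmul f p q') \<le> principal Y"
      by (rule fmul_principal) (rule YY)
    then have "fmul f (fmul f q (fmul f p q')) p \<le> F" unfolding F_def by (rule fmul_mono) simp
    then show "fmul f r r' \<le> F" by (simp add: fmul_assoc flip: q(3) q'(3))
  qed
  moreover have "F \<noteq> bot"
    unfolding F_def using ne(2) p(1)
    by (intro fmul_neq_bot) (auto simp: ultra_def principal_eq_bot_iff)
  ultimately obtain e where e: "ultra e" "e \<le> F" "fmul f e e = e" by (rule ellis_idempotent)
  obtain q where q: "ultra q" "q \<le> principal Y" "fmul f q p = e"
    using p e unfolding F_def by (metis le_fmulE)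
  have ep: "fmul f e p = e" by (metis q(3) fmul_assoc p(3))
  have eY: "e \<le> principal Y"
    unfolding q(3)[symmetric] by (rule fmul_principal[OF q(2) p(2)]) (rule YX)
  \<comment> \<open>So far only \<open>e p = e\<close> is known; multiplying by \<open>p\<close> on
    the left makes both products with \<open>p\<close> trivial. Idempotence survives:
    \<open>(p e) (p e) = p (e p) e = p e\<close>.\<close>
  define p1 where "p1 = fmul f p e"
  have p1: "ultra p1" "fmul f p1 p1 = p1" "fmul f p p1 = p1" "fmul f p1 p = p1"
    using p e ep by (auto simp: p1_def ultra_fmul) (metis fmul_assoc)+
  moreover have p1Y: "p1 \<le> principal Y"
    unfolding p1_def by (rule fmul_principal[OF p(2) eY]) (rule XY)
  moreover have "filtermap r p1 = p" if r: "r \<in> R" for r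
  proof (rule min)
    have "filtermap r p = p"
      using p(2) unfolding le_principal
      by (intro filtermap_eventually_id, elim eventually_mono) (rule rX[OF r])
    have rmul: "filtermap r (fmul f s t) = fmul f (filtermap r s) (filtermap r t)" for s t
      by (rule filtermap_fmul) (rule hom[OF r])
    show "ultra (filtermap r p1)" using p1(1) by (rule ultra_filtermap)
    show "filtermap r p1 \<le> principal X"
      using p1Y by (auto simp: le_principal eventually_filtermap elim!: eventually_mono intro: rY[OF r])
    show "fmul f (filtermap r p1) (filtermap r p1) = filtermap r p1"
      using p1(2) by (metis rmul)
    show "fmul f (filtermap r p1) p = filtermap r p1"
      using p1(4) \<open>filtermap r p = p\<close> by (metis rmul)
    show "fmul f p (filtermap r p1) = filtermap r p1"
      using p1(3) \<open>filtermap r p = p\<close> by (metis rmul)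
  qed
  ultimately show thesis using that[OF p(1-3)] by blast
qed

end

section \<open>Substitution maps on the Graham--Rothschild semigroup\<close>

text \<open>Trades least positions for a condition on all occurrences of \<open>d\<close>, which is
  easier to carry through concatenation and substitution.\<close>

lemma first_occ_less_iff:
  assumes "c \<in> set u" "d \<in> set u"
  shows "first_occ u c < first_occ u d \<longleftrightarrow> (\<forall>t<length u. u ! t = d \<longrightarrow> (\<exists>s<t. u ! s = c))"
proof -
  have occ: "first_occ u a < length u \<and> u ! first_occ u a = a" if "a \<in> set u" for a
    unfolding first_occ_def by (rule LeastI_ex) (use that in \<open>auto simp: in_set_conv_nth\<close>)
  have le: "first_occ u a \<le> n" if "n < length u" "u ! n = a" for a n
    unfolding first_occ_def by (rule Least_le) (use that in simp)
  show ?thesis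
  proof
    assume "first_occ u c < first_occ u d"
    then show "\<forall>t<length u. u ! t = d \<longrightarrow> (\<exists>s<t. u ! s = c)"
      using occ[OF assms(1)] le less_le_trans by blast
  next
    assume "\<forall>t<length u. u ! t = d \<longrightarrow> (\<exists>s<t. u ! s = c)"
    then obtain s where "s < first_occ u d" "u ! s = c" using occ[OF assms(2)] by blast
    moreover from this have "first_occ u c \<le> s" using occ[OF assms(2)] by (intro le) auto
    ultimately show "first_occ u c < first_occ u d" by simp
  qed
qed

text \<open>The bound \<open>j \<le> k\<close> disappears because an occurrence of
  \<open>Var j\<close> in \<open>u\<close> already forces it.\<close>

lemma gr_layer_iff:
  "u \<in> gr_layer A k \<longleftrightarrow> set u \<subseteq> Const ` A \<union> Var ` {1..k} \<and> Var ` {1..k} \<subseteq> set u \<and>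
     (\<forall>i j t. 1 \<le> i \<and> i < j \<and> t < length u \<and> u ! t = Var j \<longrightarrow> (\<exists>s<t. u ! s = Var i))"
proof (cases "set u \<subseteq> Const ` A \<union> Var ` {1..k} \<and> Var ` {1..k} \<subseteq> set u")
  case True
  have occ: "first_occ u (Var i) < first_occ u (Var j) \<longleftrightarrow>
      (\<forall>t<length u. u ! t = Var j \<longrightarrow> (\<exists>s<t. u ! s = Var i))"
    if "1 \<le> i" "i < j" "j \<le> k" for i j
    using True that by (intro first_occ_less_iff) auto
  have le: "j \<le> k" if "t < length u" "u ! t = Var j" for j t
  proof -
    have "Var j \<in> set u" using that by (metis nth_mem)
    with True show ?thesis by auto
  qed
  have "(\<forall>i j. 1 \<le> i \<and> i < j \<and> j \<le> k \<longrightarrow> first_occ u (Var i) < first_occ u (Var j)) \<longleftrightarrow>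
      (\<forall>i j t. 1 \<le> i \<and> i < j \<and> t < length u \<and> u ! t = Var j \<longrightarrow> (\<exists>s<t. u ! s = Var i))"
    using occ le by meson
  with True show ?thesis by (simp add: gr_layer_def)
qed (auto simp: gr_layer_def)

lemma inf_param_word_iff:
  "inf_param_word A w \<longleftrightarrow>
     range w \<subseteq> Const ` A \<union> Var ` {1..} \<and> Var ` {1..} \<subseteq> range w \<and>
     (\<forall>i j t. 1 \<le> i \<and> i < j \<and> w t = Var j \<longrightarrow> (\<exists>s<t. w s = Var i))"
proof (cases "Var ` {1..} \<subseteq> range w")
  case True
  have ex: "\<exists>n. w n = Var i" if "1 \<le> i" for i
  proof -
    have "Var i \<in> range w" using True that by auto
    then show ?thesis by (metis rangeE)
  qed
  have less: "(LEAST n. w n = Var i) < (LEAST n. w n = Var j) \<longleftrightarrow>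
      (\<forall>t. w t = Var j \<longrightarrow> (\<exists>s<t. w s = Var i))" if "1 \<le> i" "i < j" for i j
  proof -
    have i: "w (LEAST n. w n = Var i) = Var i"
      by (rule LeastI_ex) (use that in \<open>simp add: ex\<close>)
    have j: "w (LEAST n. w n = Var j) = Var j"
      by (rule LeastI_ex) (use that in \<open>simp add: ex\<close>)
    show ?thesis
    proof
      assume "(LEAST n. w n = Var i) < (LEAST n. w n = Var j)"
      then show "\<forall>t. w t = Var j \<longrightarrow> (\<exists>s<t. w s = Var i)"
        using i Least_le[of "\<lambda>n. w n = Var j"] by (meson less_le_trans)
    next
      assume "\<forall>t. w t = Var j \<longrightarrow> (\<exists>s<t. w s = Var i)"
      then show "(LEAST n. w n = Var i) < (LEAST n. w n = Var j)"
        using j Least_le[of "\<lambda>n. w n = Var i"] by (meson le_less_trans)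
    qed
  qed
  have "(\<forall>i j. 1 \<le> i \<and> i < j \<longrightarrow> (LEAST n. w n = Var i) < (LEAST n. w n = Var j)) \<longleftrightarrow>
      (\<forall>i j t. 1 \<le> i \<and> i < j \<and> w t = Var j \<longrightarrow> (\<exists>s<t. w s = Var i))"
    using less by meson
  then show ?thesis by (simp add: inf_param_word_def)
qed (auto simp: inf_param_word_def)

lemma gr_layer_0: "gr_layer A 0 = {u. set u \<subseteq> Const ` A}"
  by (auto simp: gr_layer_def)

lemma gr_layer_1:
  "gr_layer A (Suc 0) = {u. set u \<subseteq> insert (Var (Suc 0)) (Const ` A) \<and> Var (Suc 0) \<in> set u}"
  by (auto simp: gr_layer_def)

lemma subst_word_append: "subst_word w (u @ v) = subst_word w u @ subst_word w v"
  by (simp add: subst_word_def)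

lemma subst_word_gr_layer_0: "u \<in> gr_layer A 0 \<Longrightarrow> subst_word w u = u"
  unfolding gr_layer_0 subst_word_def by (rule map_idI) auto

text \<open>The variable with index \<open>Suc j\<close> receives the character \<open>w j\<close>,
  because positions of \<open>w\<close> start at 0.\<close>

lemma subst_word_subst_word_const:
  "subst_word w (subst_word (\<lambda>_. Var (Suc j)) u) = subst_word (\<lambda>_. w j) u"
  by (auto simp: subst_word_def split: letter.split)

text \<open>The renamed variable occurs only in the right factor, after all earlier variables have
  appeared in \<open>u\<close>.\<close>

lemma append_gr_layer:
  assumes u: "u \<in> gr_layer A k" and v: "v \<in> gr_layer A (Suc 0)"
  shows "u @ subst_word (\<lambda>_. Var (Suc k)) v \<in> gr_layer A (Suc k)"
proof -
  define v' where "v' = subst_word (\<lambda>_. Var (Suc k)) v"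
  have v': "set v' \<subseteq> insert (Var (Suc k)) (Const ` A)" "Var (Suc k) \<in> set v'"
    using v by (force simp: v'_def subst_word_def gr_layer_1 split: letter.split)+
  have u': "set u \<subseteq> Const ` A \<union> Var ` {1..k}" "Var ` {1..k} \<subseteq> set u"
    "\<And>i j t. 1 \<le> i \<Longrightarrow> i < j \<Longrightarrow> t < length u \<Longrightarrow> u ! t = Var j \<Longrightarrow> \<exists>s<t. u ! s = Var i"
    using u by (auto simp: gr_layer_iff)
  have "set (u @ v') \<subseteq> Const ` A \<union> Var ` {1..Suc k}"
    using u'(1) v'(1) by (fastforce simp: atLeastAtMostSuc_conv)
  moreover have "Var ` {1..Suc k} \<subseteq> set (u @ v')"
    using u'(2) v'(2) by (auto simp: atLeastAtMostSuc_conv)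
  moreover have "\<exists>s<t. (u @ v') ! s = Var i"
    if ij: "1 \<le> i" "i < j" and t: "t < length (u @ v')" "(u @ v') ! t = Var j" for i j t
  proof (cases "t < length u")
    case True
    then obtain s where "s < t" "u ! s = Var i"
      using u'(3)[OF ij, of t] t by (auto simp: nth_append)
    with True show ?thesis by (intro exI[of _ s]) (simp add: nth_append)
  next
    case False
    then have "t - length u < length v'" "v' ! (t - length u) = Var j"
      using t by (auto simp: nth_append)
    then have "Var j \<in> set v'" by (metis nth_mem)
    then have "j = Suc k" using v'(1) by auto
    then have "Var i \<in> set u" using ij u'(2) by auto
    then obtain s where "s < length u" "u ! s = Var i" by (auto simp: in_set_conv_nth)
    with False show ?thesis by (intro exI[of _ s]) (simp add: nth_append)
  qed
  ultimately show ?thesis unfolding gr_layer_iff v'_def[symmetric] by blast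
qed

lemma strong_param_word_D:
  assumes "strong_param_word A w"
  shows "range w \<subseteq> Const ` A \<union> Var ` {1..}"
    and "1 \<le> i \<Longrightarrow> i < j \<Longrightarrow> w t = Var j \<Longrightarrow> \<exists>s<t. w s = Var i"
    and "1 \<le> i \<Longrightarrow> i < j \<Longrightarrow> w p = Var i \<Longrightarrow> w q = Var j \<Longrightarrow> p < q"
  using assms by (auto simp: strong_param_word_def inf_param_word_iff)

text \<open>Strongness forbids a return to a variable before the latest one, and the order of first
  occurrences forbids skipping one. So the next character is a letter, the latest variable or the
  first new one.\<close>

lemma strong_param_word_vars_Suc:
  assumes w: "strong_param_word A w" and k: "{i. Var i \<in> w ` {..<n}} = {1..k}"
  obtains a where "a \<in> A" "w n = Const a" "{i. Var i \<in> w ` {..<Suc n}} = {1..k}"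
  | "1 \<le> k" "w n = Var k" "{i. Var i \<in> w ` {..<Suc n}} = {1..k}"
  | "w n = Var (Suc k)" "{i. Var i \<in> w ` {..<Suc n}} = {1..Suc k}"
proof -
  have Suc: "{i. Var i \<in> w ` {..<Suc n}} = {i. Var i = w n} \<union> {1..k}"
    unfolding k[symmetric] by (auto simp: lessThan_Suc)
  have "w n \<in> Const ` A \<union> Var ` {1..}" using strong_param_word_D(1)[OF w] by auto
  then consider a where "a \<in> A" "w n = Const a" | m where "1 \<le> m" "w n = Var m" by auto
  then show thesis
  proof cases
    case 1
    then show ?thesis using Suc that(1) by simp
  next
    case (2 m)
    have "k \<le> m"
    proof (rule ccontr)
      assume "\<not> k \<le> m"
      with 2 have "k \<in> {i. Var i \<in> w ` {..<n}}" unfolding k by auto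
      then obtain s where "s < n" "w s = Var k" by auto
      then show False using strong_param_word_D(3)[OF w, of m k n s] 2 \<open>\<not> k \<le> m\<close> by auto
    qed
    moreover have "m \<le> Suc k"
    proof (rule ccontr)
      assume "\<not> m \<le> Suc k"
      then obtain s where "s < n" "w s = Var (Suc k)"
        using strong_param_word_D(2)[OF w, of "Suc k" m n] 2 by auto
      then have "Suc k \<in> {i. Var i \<in> w ` {..<n}}" by (auto intro: rev_image_eqI)
      then show False unfolding k by simp
    qed
    ultimately consider "m = k" | "m = Suc k" by linarith
    then show ?thesis
    proof cases
      case 1
      with \<open>1 \<le> m\<close> \<open>w n = Var m\<close> show ?thesis using Suc by (intro that(2)) auto
    next
      case 2
      with \<open>w n = Var m\<close> show ?thesis using Suc by (intro that(3)) auto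
    qed
  qed
qed

text \<open>Order of first occurrences is inherited in two stages: an occurrence of a later variable
  comes from some \<open>Var m\<close> in \<open>u\<close>, the earlier variable stands in
  \<open>w\<close> before position \<open>m - 1\<close>, and the variable of \<open>u\<close>
  pointing there has index below \<open>m\<close>, so it precedes \<open>Var m\<close> in
  \<open>u\<close>.\<close>

lemma subst_word_gr_layer:
  assumes w: "strong_param_word A w" and u: "u \<in> gr_layer A j"
    and k: "{i. Var i \<in> w ` {..<j}} = {1..k}"
  shows "subst_word w u \<in> gr_layer A k"
proof -
  have u': "set u \<subseteq> Const ` A \<union> Var ` {1..j}" "Var ` {1..j} \<subseteq> set u"
    "\<And>i j t. 1 \<le> i \<Longrightarrow> i < j \<Longrightarrow> t < length u \<Longrightarrow> u ! t = Var j \<Longrightarrow> \<exists>s<t. u ! s = Var i"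
    using u by (auto simp: gr_layer_iff)
  have wn: "w n \<in> Const ` A \<union> Var ` {1..k}" if "n < j" for n
  proof -
    have "w n \<in> Const ` A \<union> Var ` {1..}" using strong_param_word_D(1)[OF w] by auto
    moreover have "i \<in> {1..k}" if "w n = Var i" for i
    proof -
      have "w n \<in> w ` {..<j}" using \<open>n < j\<close> by simp
      then show ?thesis unfolding that k[symmetric] by simp
    qed
    ultimately show ?thesis by auto
  qed
  have "set (subst_word w u) \<subseteq> Const ` A \<union> Var ` {1..k}"
    unfolding subst_word_def set_map
  proof (rule image_subsetI)
    fix d assume "d \<in> set u"
    then consider a where "a \<in> A" "d = Const a" | i where "1 \<le> i" "i \<le> j" "d = Var i"
      using u'(1) by force
    then show "(case d of Const a \<Rightarrow> Const a | Var i \<Rightarrow> w (i - 1)) \<in> Const ` A \<union> Var ` {1..k}"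
    proof cases
      case 2
      then show ?thesis using wn[of "i - 1"] by simp
    qed simp
  qed
  moreover have "Var ` {1..k} \<subseteq> set (subst_word w u)"
  proof (rule image_subsetI)
    fix i assume "i \<in> {1..k}"
    then obtain n where "n < j" "w n = Var i" unfolding k[symmetric] by auto
    moreover from this have "Var (Suc n) \<in> set u" using u'(2) by auto
    ultimately show "Var i \<in> set (subst_word w u)"
      unfolding subst_word_def by (auto intro: rev_image_eqI)
  qed
  moreover have "\<exists>s<t. subst_word w u ! s = Var a"
    if ab: "1 \<le> a" "a < b" and t: "t < length (subst_word w u)" "subst_word w u ! t = Var b" for a b t
  proof -
    have tu: "t < length u" using t by (simp add: subst_word_def)
    obtain m where m: "u ! t = Var m" "w (m - 1) = Var b"
      using t tu by (auto simp: subst_word_def split: letter.splits)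
    obtain n where n: "n < m - 1" "w n = Var a" using strong_param_word_D(2)[OF w ab m(2)] by blast
    \<comment> \<open>Position \<open>n\<close> of \<open>w\<close> is addressed by
      \<open>Var (Suc n)\<close>, and \<open>n < m - 1\<close> gives
      \<open>Suc n < m\<close>.\<close>
    obtain s where "s < t" "u ! s = Var (Suc n)" using u'(3)[of "Suc n" m t] n m(1) tu less_diff_conv[of n m 1] by auto
    with n tu show ?thesis by (intro exI[of _ s]) (simp add: subst_word_def)
  qed
  ultimately show ?thesis unfolding gr_layer_iff by blast
qed

lemma strong_param_word_vars:
  assumes "strong_param_word A w"
  obtains k where "k \<le> n" "{i. Var i \<in> w ` {..<n}} = {1..k}"
proof -
  have "\<exists>k\<le>n. {i. Var i \<in> w ` {..<n}} = {1..k}"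
  proof (induction n)
    case (Suc n)
    then obtain k where k: "k \<le> n" "{i. Var i \<in> w ` {..<n}} = {1..k}" by blast
    show ?case
      by (rule strong_param_word_vars_Suc[OF assms k(2)])
        (use k(1) in \<open>blast intro: le_SucI Suc_le_mono[THEN iffD2]\<close>)+
  qed auto
  then show thesis using that by blast
qed

lemma strong_substs_maps_gr:
  assumes "f \<in> strong_substs A"
  shows "f ` (\<Union>k. gr_layer A k) \<subseteq> (\<Union>k. gr_layer A k)"
proof (rule image_subsetI)
  obtain w where w: "strong_param_word A w" and f: "f = subst_word w"
    using assms by (auto simp: strong_substs_def)
  fix u assume "u \<in> (\<Union>k. gr_layer A k)"
  then obtain j where "u \<in> gr_layer A j" by blast
  moreover obtain k where "{i. Var i \<in> w ` {..<j}} = {1..k}"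
    using w by (rule strong_param_word_vars)
  ultimately have "f u \<in> gr_layer A k" unfolding f using w by (intro subst_word_gr_layer)
  then show "f u \<in> (\<Union>k. gr_layer A k)" by blast
qed

section \<open>Coherent ultrafilters on the Graham-Rothschild semigroup\<close>

lemma coherent_ultrafilters:
  fixes A :: "'a set"
  shows "\<exists>q :: nat \<Rightarrow> 'a letter list filter. \<forall>j. ultra (q j) \<and> q j \<le> principal (gr_layer A j) \<and>
    (\<forall>f\<in>strong_substs A. \<exists>k\<le>j. filtermap f (q j) = q k)"
proof -
  let ?mul = "fmul ((@) :: 'a letter list \<Rightarrow> _)"
  obtain p0 p1 where p0: "ultra p0" "p0 \<le> principal (gr_layer A 0)" "?mul p0 p0 = p0"
    and p1: "ultra p1" "p1 \<le> principal (gr_layer A (Suc 0))" "?mul p1 p1 = p1" "?mul p1 p0 = p1"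
    and p0_p1: "?mul p0 p1 = p1"
    and r: "\<And>r. r \<in> (\<lambda>a. subst_word (\<lambda>_. Const a)) ` A \<Longrightarrow> filtermap r p1 = p0"
  proof (rule append.retraction_idempotents[where X = "gr_layer A 0" and Y = "gr_layer A (Suc 0)"
        and R = "(\<lambda>a. subst_word (\<lambda>_. Const a)) ` A"])
    have "[] \<in> gr_layer A 0" "[Var (Suc 0)] \<in> gr_layer A (Suc 0)"
      by (simp_all add: gr_layer_0 gr_layer_1)
    then show "gr_layer A 0 \<noteq> {}" "gr_layer A (Suc 0) \<noteq> {}" by blast+
  next
    fix s and y :: "'a letter list"
    assume "s \<in> (\<lambda>a. subst_word (\<lambda>_. Const a)) ` A" "y \<in> gr_layer A (Suc 0)"
    then show "s y \<in> gr_layer A 0"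
      by (force simp: gr_layer_0 gr_layer_1 subst_word_def subset_iff split: letter.split)
  qed (auto simp: gr_layer_0 gr_layer_1 subst_word_append subst_word_gr_layer_0)
  \<comment> \<open>Words of the first layer contain only \<open>Var 1\<close>, so a constant
    sequence renames that variable to \<open>c\<close>. For a letter of \<open>A\<close> the image
    is \<open>p0\<close>.\<close>
  define \<phi> where "\<phi> c = filtermap (subst_word (\<lambda>_. c)) p1" for c :: "'a letter"
  define q where "q = rec_nat p0 (\<lambda>k p. ?mul p (\<phi> (Var (Suc k))))"
  have q_simps: "q 0 = p0" "q (Suc k) = ?mul (q k) (\<phi> (Var (Suc k)))" for k
    by (simp_all add: q_def)
  have map_p0: "filtermap (subst_word w) p0 = p0" for w
    using p0(2) unfolding le_principal
    by (intro filtermap_eventually_id, elim eventually_mono) (rule subst_word_gr_layer_0)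
  have map_mul: "filtermap (subst_word w) (?mul s t) =
      ?mul (filtermap (subst_word w) s) (filtermap (subst_word w) t)" for w s t
    by (rule filtermap_fmul) (rule subst_word_append)
  have \<phi>: "ultra (\<phi> c)" "?mul (\<phi> c) (\<phi> c) = \<phi> c" "?mul (\<phi> c) p0 = \<phi> c" for c
  proof -
    show "ultra (\<phi> c)" unfolding \<phi>_def using p1(1) by (rule ultra_filtermap)
    show "?mul (\<phi> c) (\<phi> c) = \<phi> c" unfolding \<phi>_def map_mul[symmetric] p1(3) ..
    show "?mul (\<phi> c) p0 = \<phi> c" by (metis \<phi>_def map_mul map_p0 p1(4))
  qed
  \<comment> \<open>The last factor of \<open>q k\<close> is \<open>p0\<close> or some
    \<open>\<phi> c\<close>, and each absorbs \<open>p0\<close> on its right. Letters in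
    \<open>w\<close> therefore leave the product unchanged.\<close>
  have q_p0: "?mul (q k) p0 = q k" for k
    by (cases k) (simp_all add: q_simps p0 append.fmul_assoc \<phi>)
  have "ultra (q k)" for k
    by (induction k) (simp_all add: q_simps p0 ultra_fmul \<phi>)
  moreover have "q k \<le> principal (gr_layer A k)" for k
  proof (induction k)
    case (Suc k)
    have "\<phi> (Var (Suc k)) \<le> principal (subst_word (\<lambda>_. Var (Suc k)) ` gr_layer A (Suc 0))"
      using p1(2) unfolding \<phi>_def le_principal eventually_filtermap
      by (rule eventually_mono) (rule imageI)
    with Suc show ?case
      unfolding q_simps by (rule fmul_principal) (auto intro: append_gr_layer)
  qed (simp add: q_simps p0)
  moreover have "\<exists>k\<le>j. filtermap f (q j) = q k" if f: "f \<in> strong_substs A" for f j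
  proof -
    obtain w where w: "strong_param_word A w" and fw: "f = subst_word w"
      using f by (auto simp: strong_substs_def)
    \<comment> \<open>The induction also records which variables have been seen, since this decides
      what the next character of \<open>w\<close> can be.\<close>
    have "\<exists>k\<le>j. {i. Var i \<in> w ` {..<j}} = {1..k} \<and> filtermap f (q j) = q k"
    proof (induction j)
      case 0
      then show ?case by (simp add: q_simps fw map_p0)
    next
      case (Suc j)
      then obtain k where k: "k \<le> j" "{i. Var i \<in> w ` {..<j}} = {1..k}" "filtermap f (q j) = q k"
        by blast
      have "filtermap f (\<phi> (Var (Suc j))) = \<phi> (w j)"
        by (simp add: \<phi>_def fw filtermap_filtermap subst_word_subst_word_const)
      then have map_Suc: "filtermap f (q (Suc j)) = ?mul (q k) (\<phi> (w j))"
        using k(3) by (simp add: q_simps fw map_mul)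
      show ?case
      proof (rule strong_param_word_vars_Suc[OF w k(2)])
        fix a assume a: "a \<in> A" "w j = Const a" "{i. Var i \<in> w ` {..<Suc j}} = {1..k}"
        have "\<phi> (w j) = p0" using a r by (simp add: \<phi>_def)
        then show ?thesis using a(3) k(1) map_Suc q_p0 by (intro exI[of _ k]) simp
      next
        assume a: "1 \<le> k" "w j = Var k" "{i. Var i \<in> w ` {..<Suc j}} = {1..k}"
        \<comment> \<open>As \<open>k\<close> is positive, the last factor of \<open>q k\<close> is
          \<open>\<phi> (Var k)\<close>, which absorbs a second copy of itself by
          idempotence.\<close>
        then obtain k' where "k = Suc k'" by (cases k) auto
        then have "?mul (q k) (\<phi> (w j)) = q k" by (simp add: a(2) q_simps append.fmul_assoc \<phi>)
        then show ?thesis using a(3) k(1) map_Suc by (intro exI[of _ k]) simp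
      next
        assume a: "w j = Var (Suc k)" "{i. Var i \<in> w ` {..<Suc j}} = {1..Suc k}"
        then show ?thesis using k(1) map_Suc by (intro exI[of _ "Suc k"]) (simp add: q_simps)
      qed
    qed
    then show ?thesis by blast
  qed
  ultimately show ?thesis by (intro exI[of _ q]) blast
qed

section \<open>Stars of sets and of functions\<close>

context nonstandard_universe
begin

lemma
  assumes "in_universe U X"
  shows members_coll [simp]: "members U (coll U X) = X"
    and is_set_coll [simp]: "is_set U (coll U X)"
proof -
  obtain s where s: "is_set U s" "members U s = X"
    using assms by (auto simp: in_universe_def)
  have "is_set U (coll U X) \<and> members U (coll U X) = X"
    unfolding coll_def
  proof (rule theI)
    show "is_set U s \<and> members U s = X" using s ..
  qed (use s extensional in blast)
  then show "members U (coll U X) = X" "is_set U (coll U X)" by auto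
qed

lemma elt_coll [simp]: "in_universe U X \<Longrightarrow> elt U x (coll U X) \<longleftrightarrow> x \<in> X"
  using members_coll by (auto simp: members_def)

lemma closed_singleton: "in_universe U {a}"
  using closed_pair[of a a] by simp

lemma elt_is_set: "elt U x s \<Longrightarrow> is_set U s"
  using atoms_empty by (auto simp: members_def)

text \<open>A member \<open>a\<close> witnesses that \<open>s\<close> is a set and not an atom, so
  extensionality applies.\<close>

lemma eq_collI: "in_universe U X \<Longrightarrow> elt U a s \<Longrightarrow> members U s = X \<Longrightarrow> s = coll U X"
  by (rule extensional) (auto intro: elt_is_set)

lemma members_opair:
  "members U (opair U a b) = {coll U {a}, coll U {a, b}}" "is_set U (opair U a b)"
  by (simp_all add: opair_def closed_pair)

lemma opair_inject: "opair U a b = opair U c d \<longleftrightarrow> a = c \<and> b = d"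
proof
  assume "opair U a b = opair U c d"
  then have *: "{coll U {a}, coll U {a, b}} = {coll U {c}, coll U {c, d}}"
    by (metis members_opair(1))
  have "members U ` {coll U {a}, coll U {a, b}} = members U ` {coll U {c}, coll U {c, d}}"
    by (simp only: *)
  then have "{{a}, {a, b}} = {{c}, {c, d}}"
    by (simp add: closed_pair closed_singleton)
  then show "a = c \<and> b = d"
    by (auto simp: doubleton_eq_iff)
qed auto

text \<open>\<open>v\<^sub>z\<close> is the Kuratowski pair of \<open>v\<^sub>x\<close> and \<open>v\<^sub>y\<close>; the indices must be smaller than 10, since
  10, 11 and 12 are bound.\<close>

definition pair_fm :: "nat \<Rightarrow> nat \<Rightarrow> nat \<Rightarrow> bfm" where
  "pair_fm z x y = BEx 10 z (BEx 11 z (Conj (BAll 12 z (Disj (Eql 12 10) (Eql 12 11)))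
     (Conj (Conj (Mem x 10) (BAll 12 10 (Eql 12 x)))
       (Conj (Mem x 11) (Conj (Mem y 11) (BAll 12 11 (Disj (Eql 12 x) (Eql 12 y))))))))"

text \<open>The assignment is arbitrary, so the formula keeps its meaning when \<open>e\<close> is
  replaced by \<open>star U \<circ> e\<close>; this is how pairs pass through transfer.\<close>

lemma bsat_pair_fm:
  assumes "z < 10" "x < 10" "y < 10"
  shows "bsat (elt U) e (pair_fm z x y) \<longleftrightarrow> e z = opair U (e x) (e y)"
proof -
  have "bsat (elt U) e (pair_fm z x y) \<longleftrightarrow>
      (\<exists>s. elt U s (e z) \<and> (\<exists>t. elt U t (e z) \<and> (\<forall>q. elt U q (e z) \<longrightarrow> q = s \<or> q = t) \<and>
        (elt U (e x) s \<and> (\<forall>q. elt U q s \<longrightarrow> q = e x)) \<and>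
        elt U (e x) t \<and> elt U (e y) t \<and> (\<forall>q. elt U q t \<longrightarrow> q = e x \<or> q = e y)))"
    using assms by (simp add: pair_fm_def)
  also have "\<dots> \<longleftrightarrow> (\<exists>s t. members U (e z) = {s, t} \<and> members U s = {e x} \<and> members U t = {e x, e y})"
  proof -
    have "members U w = {a, b} \<longleftrightarrow> elt U a w \<and> elt U b w \<and> (\<forall>q. elt U q w \<longrightarrow> q = a \<or> q = b)"
      and "members U w = {a} \<longleftrightarrow> elt U a w \<and> (\<forall>q. elt U q w \<longrightarrow> q = a)" for w a b
      by (auto simp: members_def)
    then show ?thesis by (simp only:) blast
  qed
  also have "\<dots> \<longleftrightarrow> e z = opair U (e x) (e y)"
  proof
    assume "\<exists>s t. members U (e z) = {s, t} \<and> members U s = {e x} \<and> members U t = {e x, e y}"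
    then obtain s t where st: "members U (e z) = {s, t}" "members U s = {e x}" "members U t = {e x, e y}"
      by blast
    then have "elt U s (e z)" "elt U (e x) s" "elt U (e x) t" by (auto simp: members_def)
    then show "e z = opair U (e x) (e y)"
      unfolding opair_def using st eq_collI closed_pair closed_singleton by metis
  next
    assume "e z = opair U (e x) (e y)"
    then show "\<exists>s t. members U (e z) = {s, t} \<and> members U s = {e x} \<and> members U t = {e x, e y}"
      using members_opair(1) closed_pair closed_singleton members_coll by metis
  qed
  finally show ?thesis .
qed

section \<open>Transfer for sets and graphs of functions\<close>

lemma hyper_ext_1: "hyper_ext U \<iota> (Suc 0) B = members U (star U (coll U (\<iota> ` B)))"
  by (simp add: hyper_ext_def)

lemma in_universe_image: "in_universe U (\<iota> ` S) \<Longrightarrow> B \<subseteq> S \<Longrightarrow> in_universe U (\<iota> ` B)"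
  by (meson closed_subset image_mono)

lemma hyper_ext_disjoint:
  assumes "in_universe U (\<iota> ` S)" "inj_on \<iota> S" "B \<subseteq> S" "C \<subseteq> S" "B \<inter> C = {}"
  shows "hyper_ext U \<iota> 1 B \<inter> hyper_ext U \<iota> 1 C = {}"
proof -
  define e :: "nat \<Rightarrow> 'v" where "e = (\<lambda>_. coll U (\<iota> ` C))(0 := coll U (\<iota> ` B))"
  have B: "in_universe U (\<iota> ` B)" and C: "in_universe U (\<iota> ` C)"
    using assms in_universe_image by blast+
  have "\<iota> ` B \<inter> \<iota> ` C = {}"
    using assms by (metis image_empty inj_on_image_Int)
  then have "bsat (elt U) e (BAll 2 0 (Neg (Mem 2 1)))"
    using B C by (auto simp: e_def)
  then have "bsat (elt U) (star U \<circ> e) (BAll 2 0 (Neg (Mem 2 1)))" by (rule transfer[THEN iffD1])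
  then show ?thesis by (auto simp: e_def hyper_ext_1 members_def)
qed

text \<open>Four facts about the graph of \<open>f\<close> are transferred: it is total, consists of
  pairs over \<open>S\<close>, is single-valued, and relates \<open>B\<close> to its preimage. The
  first three make the description in \<open>hyper_map\<close> well defined, and the last gives the
  equivalence.\<close>

lemma hyper_map_in_hyper_ext_iff:
  assumes S: "in_universe U (\<iota> ` S)" and inj: "inj_on \<iota> S" and f: "f ` S \<subseteq> S" and B: "B \<subseteq> S"
    and \<alpha>: "\<alpha> \<in> hyper_ext U \<iota> 1 S"
  shows "hyper_map U \<iota> S 1 f \<alpha> \<in> hyper_ext U \<iota> 1 B \<longleftrightarrow> \<alpha> \<in> hyper_ext U \<iota> 1 {u \<in> S. f u \<in> B}"
proof -
  define G where "G = {opair U (\<iota> u) (\<iota> (f u)) | u. u \<in> S}"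
  define C where "C = {u \<in> S. f u \<in> B}"
  \<comment> \<open>Variables 0 to 3 name \<open>S\<close>, the graph, \<open>B\<close> and its
    preimage; those from 4 on are bound in the formulas.\<close>
  define e :: "nat \<Rightarrow> 'v" where "e = (\<lambda>_. coll U (\<iota> ` S))
    (1 := coll U G, 2 := coll U (\<iota> ` B), 3 := coll U (\<iota> ` C))"
  have univ: "in_universe U (\<iota> ` B)" "in_universe U (\<iota> ` C)"
    using in_universe_image[OF S] B by (auto simp: C_def)
  have "G \<subseteq> {opair U a b | a b. a \<in> \<iota> ` S \<and> b \<in> \<iota> ` S}"
    unfolding G_def using f by blast
  then have G: "in_universe U G" using closed_Times[OF S S] closed_subset by blast
  have mem_G: "z \<in> G \<longleftrightarrow> (\<exists>u\<in>S. z = opair U (\<iota> u) (\<iota> (f u)))" for z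
    by (auto simp: G_def)
  have IB: "\<iota> u \<in> \<iota> ` B \<longleftrightarrow> u \<in> B" if "u \<in> S" for u
    using that B inj by (meson inj_on_image_mem_iff)
  have IC: "\<iota> u \<in> \<iota> ` C \<longleftrightarrow> f u \<in> B" if "u \<in> S" for u
    using that inj inj_on_image_mem_iff[of \<iota> S u C] by (auto simp: C_def)

  have "bsat (elt U) e (BAll 4 0 (BEx 5 0 (BEx 6 1 (pair_fm 6 4 5))))"
    using f by (auto simp: e_def bsat_pair_fm S G univ mem_G opair_inject image_subset_iff)
  then have "bsat (elt U) (star U \<circ> e) (BAll 4 0 (BEx 5 0 (BEx 6 1 (pair_fm 6 4 5))))"
    by (rule transfer[THEN iffD1])
  then have total: "\<exists>\<beta>. elt U (opair U x \<beta>) (star U (coll U G))"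
    if "elt U x (star U (coll U (\<iota> ` S)))" for x
    using that by (auto simp: e_def bsat_pair_fm)

  \<comment> \<open>The later formulas quantify only over the star of \<open>S\<close>, so every
    pair in the star of the graph must first be shown to have its components there.\<close>
  have "bsat (elt U) e (BAll 6 1 (BEx 4 0 (BEx 5 0 (pair_fm 6 4 5))))"
    using f by (auto simp: e_def bsat_pair_fm S G univ mem_G)
  then have *: "bsat (elt U) (star U \<circ> e) (BAll 6 1 (BEx 4 0 (BEx 5 0 (pair_fm 6 4 5))))"
    by (rule transfer[THEN iffD1])
  have pairs: "elt U x (star U (coll U (\<iota> ` S))) \<and> elt U y (star U (coll U (\<iota> ` S)))"
    if "elt U (opair U x y) (star U (coll U G))" for x y
  proof -
    have "\<exists>a. elt U a (star U (coll U (\<iota> ` S))) \<and> (\<exists>b. elt U b (star U (coll U (\<iota> ` S))) \<and>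
        opair U x y = opair U a b)"
      using * that by (simp add: e_def bsat_pair_fm)
    then show ?thesis by (auto simp: opair_inject)
  qed

  let ?single = "BAll 4 0 (BAll 5 0 (BAll 7 0 (BAll 6 1 (BAll 8 1
    (Impl (pair_fm 6 4 5) (Impl (pair_fm 8 4 7) (Eql 5 7)))))))"
  have "bsat (elt U) e ?single"
    by (simp add: e_def bsat_pair_fm S G univ mem_G opair_inject) (metis inj inj_onD)
  then have "bsat (elt U) (star U \<circ> e) ?single" by (rule transfer[THEN iffD1])
  then have single: "y = y'"
    if "elt U (opair U x y) (star U (coll U G))" "elt U (opair U x y') (star U (coll U G))" for x y y'
    using that pairs[OF that(1)] pairs[OF that(2)] by (auto simp: e_def bsat_pair_fm)

  let ?preimage = "BAll 4 0 (BAll 5 0 (BAll 6 1 (Impl (pair_fm 6 4 5)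
    (Conj (Impl (Mem 5 2) (Mem 4 3)) (Impl (Mem 4 3) (Mem 5 2))))))"
  have "bsat (elt U) e ?preimage"
    by (simp add: e_def bsat_pair_fm S G univ mem_G opair_inject) (metis IB IC f image_subset_iff)
  then have "bsat (elt U) (star U \<circ> e) ?preimage" by (rule transfer[THEN iffD1])
  then have preimage: "elt U y (star U (coll U (\<iota> ` B))) \<longleftrightarrow> elt U x (star U (coll U (\<iota> ` C)))"
    if "elt U (opair U x y) (star U (coll U G))" for x y
    using that pairs[OF that] by (auto simp: e_def bsat_pair_fm)

  obtain \<beta> where \<beta>: "elt U (opair U \<alpha> \<beta>) (star U (coll U G))"
    using total \<alpha> by (auto simp: hyper_ext_1 members_def)
  have "hyper_map U \<iota> S 1 f \<alpha> = \<beta>"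
    unfolding hyper_map_def
    by (rule the_equality) (use \<beta> single in \<open>auto simp: members_def simp flip: G_def\<close>)
  then show ?thesis
    using preimage[OF \<beta>] by (simp add: hyper_ext_1 members_def flip: C_def)
qed

text \<open>In terms of ultrafilters: passing from \<open>\<alpha>\<close> to its image under the
  extended map is taking the image filter under \<open>f\<close>.\<close>

lemma generated_hyper_map:
  assumes "in_universe U (\<iota> ` S)" "inj_on \<iota> S" "f ` S \<subseteq> S" "\<alpha> \<in> hyper_ext U \<iota> 1 S"
  shows "generated U \<iota> S 1 (hyper_map U \<iota> S 1 f \<alpha>) =
    {B. B \<subseteq> S \<and> {u \<in> S. f u \<in> B} \<in> generated U \<iota> S 1 \<alpha>}"
  using hyper_map_in_hyper_ext_iff[OF assms(1-3) _ assms(4)] by (auto simp: generated_def)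

text \<open>The sets in \<open>p\<close> have the finite intersection property, and countability of
  \<open>S\<close> bounds their number by the continuum, so enlarging puts some
  \<open>\<alpha>\<close> in all their stars. A set outside \<open>p\<close> has its complement in
  \<open>p\<close>, and disjoint sets have disjoint stars, so \<open>\<alpha>\<close> generates
  nothing more.\<close>

lemma generator_exists:
  assumes S: "in_universe U (\<iota> ` S)" and inj: "inj_on \<iota> S" and "countable S"
    and not_bot: "p \<noteq> bot" and ultra: "\<And>P. eventually P p \<or> eventually (\<lambda>x. \<not> P x) p"
    and pS: "eventually (\<lambda>u. u \<in> S) p"
  shows "\<exists>\<alpha>. generated U \<iota> S 1 \<alpha> = {B. B \<subseteq> S \<and> eventually (\<lambda>u. u \<in> B) p}"
proof -
  define D where "D = {B. B \<subseteq> S \<and> eventually (\<lambda>u. u \<in> B) p}"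
  define F where "F = (\<lambda>B. \<iota> ` B) ` D"
  have "\<exists>\<alpha>. \<forall>X\<in>F. \<alpha> \<in> members U (star U (coll U X))"
  proof (rule enlarging)
    show "\<forall>X\<in>F. in_universe U X"
      using in_universe_image[OF S] by (auto simp: F_def D_def)
    have "F \<lesssim> Pow S"
      unfolding F_def by (rule lepoll_trans[OF image_lepoll]) (auto simp: D_def intro: subset_imp_lepoll)
    also have "Pow S \<lesssim> (UNIV :: nat set set)"
      unfolding lepoll_def
    proof (intro exI conjI)
      show "inj_on (\<lambda>B. to_nat_on S ` B) (Pow S)"
        using \<open>countable S\<close> by (intro inj_on_image_Pow inj_on_to_nat_on)
    qed auto
    also have "(UNIV :: nat set set) \<lesssim> (UNIV :: real set)"
      using nat_sets_eqpoll_reals by (rule eqpoll_imp_lepoll)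
    finally show "F \<lesssim> (UNIV :: real set)" .
    show "\<forall>G. G \<subseteq> F \<and> finite G \<and> G \<noteq> {} \<longrightarrow> \<Inter>G \<noteq> {}"
    proof (intro allI impI)
      fix G assume G: "G \<subseteq> F \<and> finite G \<and> G \<noteq> {}"
      then obtain E where E: "E \<subseteq> D" "finite E" "G = (\<lambda>B. \<iota> ` B) ` E"
        unfolding F_def by (meson finite_subset_image)
      then have "eventually (\<lambda>u. \<forall>B\<in>E. u \<in> B) p"
        by (auto simp: D_def eventually_ball_finite_distrib)
      with not_bot obtain u where "\<forall>B\<in>E. u \<in> B"
        by (metis (mono_tags, lifting) eventually_happens)
      then have "\<iota> u \<in> \<Inter>G" using E(3) by auto
      then show "\<Inter>G \<noteq> {}" by blast
    qed
  qed
  then obtain \<alpha> where \<alpha>: "\<And>B. B \<in> D \<Longrightarrow> \<alpha> \<in> hyper_ext U \<iota> 1 B"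
    by (auto simp: F_def hyper_ext_1)
  have "B \<in> D" if B: "B \<subseteq> S" "\<alpha> \<in> hyper_ext U \<iota> 1 B" for B
  proof (rule ccontr)
    assume "B \<notin> D"
    then have "eventually (\<lambda>u. u \<notin> B) p" using B(1) ultra by (auto simp: D_def)
    with pS have "eventually (\<lambda>u. u \<in> S - B) p" by eventually_elim simp
    then have "\<alpha> \<in> hyper_ext U \<iota> 1 (S - B)" by (intro \<alpha>) (auto simp: D_def)
    with B(2) hyper_ext_disjoint[OF S inj B(1), of "S - B"] show False by blast
  qed
  then have "generated U \<iota> S 1 \<alpha> = D" using \<alpha> by (auto simp: generated_def D_def)
  then show ?thesis unfolding D_def by blast
qed

end

section \<open>From coherent ultrafilters to coherent generators\<close>

theorem theorem6p16:
  fixes A :: "'a set"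
    and U :: "'v star_universe"
    and num :: "nat \<Rightarrow> 'v"
    and word :: "'a letter list \<Rightarrow> 'v"
  assumes "finite A"
    and "nonstandard_universe U"
    and "standard_copy U num UNIV"
    and "standard_copy U word (\<Union>k. gr_layer A k)"
  shows "\<exists>\<alpha> \<in> star_Pi U word (gr_layer A). coherent U word (gr_layer A) (strong_substs A) \<alpha>"
proof -
  interpret nonstandard_universe U by fact
  let ?S = "\<Union>k. gr_layer A k"
  have S: "in_universe U (word ` ?S)" and inj: "inj_on word ?S"
    using assms(4) by (auto simp: standard_copy_def)
  have "?S \<subseteq> lists (Const ` A \<union> range Var)"
    by (auto simp: gr_layer_def)
  moreover have "countable (Const ` A \<union> range Var)"
    using assms(1) by (simp add: countable_finite)
  ultimately have cS: "countable ?S"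
    by (meson countable_lists countable_subset)
  obtain q where "\<forall>j. ultra (q j) \<and> q j \<le> principal (gr_layer A j) \<and>
      (\<forall>f\<in>strong_substs A. \<exists>k\<le>j. filtermap f (q j) = q k)"
    by (rule exE[OF coherent_ultrafilters])
  then have q: "ultra (q j)" "q j \<le> principal (gr_layer A j)"
    "f \<in> strong_substs A \<Longrightarrow> \<exists>k\<le>j. filtermap f (q j) = q k" for j f
    by simp_all
  have qS: "\<forall>\<^sub>F u in q j. u \<in> ?S" for j
    using q(2)[of j] unfolding le_principal by (rule eventually_mono) (rule UN_I[OF UNIV_I])
  have "\<exists>\<alpha>. generated U word ?S 1 \<alpha> = {B. B \<subseteq> ?S \<and> (\<forall>\<^sub>F u in q j. u \<in> B)}" for j
  proof -
    have "q j \<noteq> bot" "eventually P (q j) \<or> eventually (\<lambda>u. \<not> P u) (q j)" for P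
      using q(1)[of j] by (simp_all add: ultra_def)
    then show ?thesis using qS by (rule generator_exists[OF S inj cS])
  qed
  then obtain \<alpha> where \<alpha>: "\<And>j. generated U word ?S 1 (\<alpha> j) = {B. B \<subseteq> ?S \<and> (\<forall>\<^sub>F u in q j. u \<in> B)}"
    by metis
  have ext: "\<alpha> j \<in> hyper_ext U word 1 B" if "B \<subseteq> ?S" "\<forall>\<^sub>F u in q j. u \<in> B" for j B
    using that \<alpha>[of j] unfolding generated_def by blast
  have "\<alpha> j \<in> hyper_ext U word 1 (gr_layer A j)" for j
    using q(2)[of j] by (intro ext) (auto simp: le_principal)
  moreover have "coherent U word (gr_layer A) (strong_substs A) \<alpha>"
    unfolding coherent_def
  proof (intro ballI allI)
    fix f j assume f: "f \<in> strong_substs A"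
    obtain k where k: "k \<le> j" "filtermap f (q j) = q k" using q(3)[OF f] by blast
    have fS: "f ` ?S \<subseteq> ?S" using f by (rule strong_substs_maps_gr)
    have "generated U word ?S 1 (hyper_map U word ?S 1 f (\<alpha> j)) =
        {B. B \<subseteq> ?S \<and> {u \<in> ?S. f u \<in> B} \<in> generated U word ?S 1 (\<alpha> j)}"
      by (rule generated_hyper_map[OF S inj fS]) (rule ext[OF order_refl qS])
    also have "\<dots> = {B. B \<subseteq> ?S \<and> (\<forall>\<^sub>F u in q j. u \<in> ?S \<and> f u \<in> B)}"
      by (simp only: \<alpha> mem_Collect_eq Collect_restrict simp_thms)
    \<comment> \<open>Membership in \<open>?S\<close> holds almost everywhere for
      \<open>q j\<close>, so only the condition on \<open>f u\<close> remains.\<close>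
    also have "\<dots> = {B. B \<subseteq> ?S \<and> (\<forall>\<^sub>F u in filtermap f (q j). u \<in> B)}"
      using qS[of j] by (simp only: eventually_conj_iff eventually_filtermap simp_thms)
    also have "\<dots> = generated U word ?S 1 (\<alpha> k)" unfolding \<alpha> k(2) ..
    finally show "\<exists>k\<le>j. sim U word ?S 1 1 (hyper_map U word ?S 1 f (\<alpha> j)) (\<alpha> k)"
      using k(1) unfolding sim_def by blast
  qed
  ultimately show ?thesis unfolding star_Pi_def by blast
qed

end
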